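(* Let $(\mathbb{L}, I)$ be a set of lines with an incidence relation satisfying Axioms [1]–[4] and the assumption of projectivity. Let the lines $u, v, w$ be pairwise skew. If $x_1, y_1, z_1 \in [uvw]$ are distinct and $x_2, y_2, z_2 \in [uvw]$ are distinct, then $[x_1 y_1 z_1] = [x_2 y_2 z_2]$.
   Context: Framework. $\mathbb{L}$ is a set whose elements are called lines, equipped with a symmetric reflexive relation $I$ called incidence ("$a$ meets $b$" means $a \, I \, b$). For $S \subseteq \mathbb{L}$, $S^{I}$ denotes the set of all lines incident to each line in $S$; write $l^{I} = \{l\}^{I}$, $[l_1 \dots l_n] = \{l_1,\dots,l_n\}^{I}$ and $[ab]^{I} = ([ab])^{I}$. Lines $a, b$ are skew if they are not incident; a skew pair in a set is a pair of skew lines both in the set. The axioms are as follows. Axiom [1]: for each line $l$ the set $l^{I}$ contains three pairwise skew lines. Axiom [2]: for each incident pair of distinct lines $a, b$: [2.1] $[ab]$ contains skew pairs of lines; [2.2] if $c \in [ab] \setminus [ab]^{I}$ (i.e. $c$ is one of a skew pair in $[ab]$) then $[abc]$ contains no skew pairs; [2.3] if $x, y$ is a skew pair in $[ab]$ then $[ab] = [abx] \cup [aby]$. Axiom [3]: if $a, b$ is an incident pair of distinct lines and $c \in [ab] \setminus [ab]^{I}$, then there exist an incident pair of distinct lines $p, q$ and $r \in [pq] \setminus [pq]^{I}$ such that $[abc] \cap [pqr] = \emptyset$. Points and planes: for distinct incident $a, b$, incidence restricts to an equivalence relation on $\Sigma(a,b) = [ab] \setminus [ab]^{I}$ with exactly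 two classes. These classes are labelled $\Sigma_{\curlyvee}(a,b)$ and $\Sigma_{\triangledown}(a,b)$ (one labelling fixed for each unordered pair $\{a,b\}$, so that Axiom [4] holds). The set $a \curlyvee b = [abc]$ for any $c \in \Sigma_{\curlyvee}(a,b)$ is independent of the choice of $c$ and is called a point; the set $a \triangledown b = [abc]$ for any $c \in \Sigma_{\triangledown}(a,b)$ is independent of the choice of $c$ and is called a plane. Axiom [4]: whenever $a, b$ and $p, q$ are pairs of distinct incident lines, $(a \curlyvee b) \cap (p \curlyvee q) \neq \emptyset$ and $(a \triangledown b) \cap (p \triangledown q) \neq \emptyset$. Regulus: for pairwise skew lines $u, v, w$, the set $[uvw]$ is called a regulus. Assumption of projectivity: for all pairwise skew lines $u, v, w$ and all distinct lines $a, b, c, d \in [uvw]$, if a line meets three of $a, b, c, d$ then it meets the fourth. (Equivalently: for all pairwise skew $u, v, w$ and distinct $x, y, z \in [uvw]$, every $l \in [uvw]$ meets every $m \in [xyz]$.) *)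

theory Defs
  imports Main
begin

text \<open>
  The lines form a carrier set \<open>L\<close>; the incidence relation \<open>I\<close> only matters on \<open>L\<close>.
  \<open>perp L I S\<close> is the set written $S^I$, so \<open>perp L I {a, b, c}\<close> is $[abc]$ and
  \<open>perp L I (perp L I {a, b})\<close> is $[ab]^I$.
\<close>

definition perp :: "'a set \<Rightarrow> ('a \<Rightarrow> 'a \<Rightarrow> bool) \<Rightarrow> 'a set \<Rightarrow> 'a set" where
  "perp L I S = {l \<in> L. \<forall>s\<in>S. I l s}"

definition skew :: "'a set \<Rightarrow> ('a \<Rightarrow> 'a \<Rightarrow> bool) \<Rightarrow> 'a \<Rightarrow> 'a \<Rightarrow> bool" where
  "skew L I a b \<longleftrightarrow> a \<in> L \<and> b \<in> L \<and> \<not> I a b"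

definition pairwise_skew :: "'a set \<Rightarrow> ('a \<Rightarrow> 'a \<Rightarrow> bool) \<Rightarrow> 'a \<Rightarrow> 'a \<Rightarrow> 'a \<Rightarrow> bool" where
  "pairwise_skew L I u v w \<longleftrightarrow> skew L I u v \<and> skew L I v w \<and> skew L I u w"

definition has_skew_pair :: "'a set \<Rightarrow> ('a \<Rightarrow> 'a \<Rightarrow> bool) \<Rightarrow> 'a set \<Rightarrow> bool" where
  "has_skew_pair L I S \<longleftrightarrow> (\<exists>x\<in>S. \<exists>y\<in>S. skew L I x y)"

definition incident_pair :: "'a set \<Rightarrow> ('a \<Rightarrow> 'a \<Rightarrow> bool) \<Rightarrow> 'a \<Rightarrow> 'a \<Rightarrow> bool" where
  "incident_pair L I a b \<longleftrightarrow> a \<in> L \<and> b \<in> L \<and> a \<noteq> b \<and> I a b"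

definition Sig :: "'a set \<Rightarrow> ('a \<Rightarrow> 'a \<Rightarrow> bool) \<Rightarrow> 'a \<Rightarrow> 'a \<Rightarrow> 'a set" where
  "Sig L I a b = perp L I {a, b} - perp L I (perp L I {a, b})"

definition Sig_rel :: "'a set \<Rightarrow> ('a \<Rightarrow> 'a \<Rightarrow> bool) \<Rightarrow> 'a \<Rightarrow> 'a \<Rightarrow> ('a \<times> 'a) set" where
  "Sig_rel L I a b = {(x, y). x \<in> Sig L I a b \<and> y \<in> Sig L I a b \<and> I x y}"

definition regulus :: "'a set \<Rightarrow> ('a \<Rightarrow> 'a \<Rightarrow> bool) \<Rightarrow> 'a \<Rightarrow> 'a \<Rightarrow> 'a \<Rightarrow> 'a set" where
  "regulus L I u v w = perp L I {u, v, w}"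

locale incidence_space =
  fixes L :: "'a set" and I :: "'a \<Rightarrow> 'a \<Rightarrow> bool"
  assumes incidence_refl: "a \<in> L \<Longrightarrow> I a a"
    and incidence_sym: "a \<in> L \<Longrightarrow> b \<in> L \<Longrightarrow> I a b \<Longrightarrow> I b a"

locale line_space_123 = incidence_space +
  assumes axiom_1:
      "l \<in> L \<Longrightarrow> \<exists>x\<in>perp L I {l}. \<exists>y\<in>perp L I {l}. \<exists>z\<in>perp L I {l}. pairwise_skew L I x y z"
    and axiom_2_1:
      "incident_pair L I a b \<Longrightarrow> has_skew_pair L I (perp L I {a, b})"
    and axiom_2_2:
      "incident_pair L I a b \<Longrightarrow> c \<in> Sig L I a b \<Longrightarrow> \<not> has_skew_pair L I (perp L I {a, b, c})"
    and axiom_2_3: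
      "incident_pair L I a b \<Longrightarrow> x \<in> perp L I {a, b} \<Longrightarrow> y \<in> perp L I {a, b} \<Longrightarrow> skew L I x y \<Longrightarrow>
        perp L I {a, b} = perp L I {a, b, x} \<union> perp L I {a, b, y}"
    and axiom_3:
      "incident_pair L I a b \<Longrightarrow> c \<in> Sig L I a b \<Longrightarrow>
        \<exists>p q r. incident_pair L I p q \<and> r \<in> Sig L I p q \<and>
          perp L I {a, b, c} \<inter> perp L I {p, q, r} = {}"
begin

lemma Sig_in: "c \<in> Sig L I a b \<Longrightarrow> c \<in> L \<and> I c a \<and> I c b"
  by (simp add: Sig_def perp_def)

lemma equiv_Sig_rel:
  assumes ab: "incident_pair L I a b"
  shows "equiv (Sig L I a b) (Sig_rel L I a b)"
proof (rule equivI)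
  show "Sig_rel L I a b \<subseteq> Sig L I a b \<times> Sig L I a b"
    by (auto simp: Sig_rel_def)
  show "refl_on (Sig L I a b) (Sig_rel L I a b)"
    using Sig_in incidence_refl by (simp add: refl_on_def Sig_rel_def)
  show "sym (Sig_rel L I a b)"
    unfolding sym_def Sig_rel_def using Sig_in incidence_sym by blast
  show "trans (Sig_rel L I a b)"
  proof (rule transI)
    fix x y z
    assume "(x, y) \<in> Sig_rel L I a b" "(y, z) \<in> Sig_rel L I a b"
    then have S: "x \<in> Sig L I a b" "y \<in> Sig L I a b" "z \<in> Sig L I a b"
      and "I x y" "I y z"
      by (simp_all add: Sig_rel_def)
    moreover have "I z y" using incidence_sym Sig_in S \<open>I y z\<close> by blast
    ultimately have "x \<in> perp L I {a, b, y}" "z \<in> perp L I {a, b, y}"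
      using Sig_in by (simp_all add: perp_def)
    then have "\<not> skew L I x z"
      using axiom_2_2[OF ab S(2)] unfolding has_skew_pair_def by blast
    then show "(x, z) \<in> Sig_rel L I a b"
      using S Sig_in by (simp add: Sig_rel_def skew_def)
  qed
qed

lemma card_Sig_quotient:
  assumes ab: "incident_pair L I a b"
  shows "card (Sig L I a b // Sig_rel L I a b) = 2"
proof -
  let ?S = "Sig L I a b" and ?r = "Sig_rel L I a b"
  from axiom_2_1[OF ab] obtain x y where
    xy: "x \<in> perp L I {a, b}" "y \<in> perp L I {a, b}" "skew L I x y"
    by (auto simp: has_skew_pair_def)
  have xS: "x \<in> ?S" and yS: "y \<in> ?S"
  proof -
    have "x \<in> L" "y \<in> L" "\<not> I x y" "\<not> I y x"
      using xy(3) incidence_sym unfolding skew_def by blast+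
    then show "x \<in> ?S" "y \<in> ?S"
      using xy(1,2) by (auto simp: Sig_def perp_def)
  qed
  have cover: "(x, z) \<in> ?r \<or> (y, z) \<in> ?r" if z: "z \<in> ?S" for z
  proof -
    have "z \<in> perp L I {a, b, x} \<union> perp L I {a, b, y}"
      using z axiom_2_3[OF ab xy] by (auto simp: Sig_def)
    then have "I z x \<or> I z y" by (auto simp: perp_def)
    moreover have "z \<in> L" "x \<in> L" "y \<in> L"
      using z xS yS Sig_in by blast+
    ultimately have "I x z \<or> I y z" using incidence_sym by blast
    then show ?thesis
      using z xS yS by (simp add: Sig_rel_def)
  qed
  have "?r `` {z} \<in> {?r `` {x}, ?r `` {y}}" if "z \<in> ?S" for z
    using cover[OF that] equiv_class_eq[OF equiv_Sig_rel[OF ab], of x z]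
      equiv_class_eq[OF equiv_Sig_rel[OF ab], of y z] by blast
  then have "?S // ?r = {?r `` {x}, ?r `` {y}}"
    using xS yS by (auto intro: quotientI elim!: quotientE)
  moreover have "?r `` {x} \<noteq> ?r `` {y}"
    using xy(3) eq_equiv_class[OF _ equiv_Sig_rel[OF ab] yS, of x]
    by (auto simp: Sig_rel_def skew_def)
  ultimately show ?thesis by simp
qed

lemma perp_Sig_class_eq:
  assumes ab: "incident_pair L I a b" and cd: "(c, d) \<in> Sig_rel L I a b"
  shows "perp L I {a, b, c} = perp L I {a, b, d}"
proof -
  have sub: "perp L I {a, b, c} \<subseteq> perp L I {a, b, d}" if cd: "(c, d) \<in> Sig_rel L I a b" for c d
  proof
    fix e assume e: "e \<in> perp L I {a, b, c}"
    have c: "c \<in> Sig L I a b" and d: "d \<in> Sig L I a b" and "I c d"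
      using cd by (simp_all add: Sig_rel_def)
    then have cL: "c \<in> L" and dL: "d \<in> L" and dab: "I d a" "I d b"
      by (simp_all add: Sig_def perp_def)
    have "I d c" using incidence_sym[OF cL dL \<open>I c d\<close>] .
    then have "d \<in> perp L I {a, b, c}" using dL dab by (simp add: perp_def)
    then have "\<not> skew L I e d"
      using e axiom_2_2[OF ab c] unfolding has_skew_pair_def by blast
    then show "e \<in> perp L I {a, b, d}"
      using e dL by (simp add: perp_def skew_def)
  qed
  have "(d, c) \<in> Sig_rel L I a b"
    using equiv_Sig_rel[OF ab] cd by (meson equivE symD)
  from sub[OF cd] sub[OF this] show ?thesis by (rule subset_antisym)
qed

end

text \<open>
  The labelling of the two classes of \<open>Sig L I a b\<close> is part of the structure: for each unordered
  pair of distinct incident lines, \<open>SigP a b\<close> is the class giving points and \<open>SigT a b\<close> the class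
  giving planes.
\<close>

locale labelled_line_space = line_space_123 +
  fixes SigP SigT :: "'a \<Rightarrow> 'a \<Rightarrow> 'a set"
  assumes label_classes:
      "incident_pair L I a b \<Longrightarrow> Sig L I a b // Sig_rel L I a b = {SigP a b, SigT a b}"
    and label_sym:
      "incident_pair L I a b \<Longrightarrow> SigP a b = SigP b a \<and> SigT a b = SigT b a"
begin

definition point :: "'a \<Rightarrow> 'a \<Rightarrow> 'a set" where
  "point a b = perp L I {a, b, SOME c. c \<in> SigP a b}"

definition plane :: "'a \<Rightarrow> 'a \<Rightarrow> 'a set" where
  "plane a b = perp L I {a, b, SOME c. c \<in> SigT a b}"

lemma labels_distinct:
  assumes "incident_pair L I a b"
  shows "SigP a b \<noteq> SigT a b"
  using card_Sig_quotient[OF assms] label_classes[OF assms] by auto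

lemma point_eq:
  assumes ab: "incident_pair L I a b" and c: "c \<in> SigP a b"
  shows "point a b = perp L I {a, b, c}"
proof -
  have "SigP a b \<in> Sig L I a b // Sig_rel L I a b"
    using label_classes[OF ab] by simp
  moreover have "(SOME c. c \<in> SigP a b) \<in> SigP a b"
    using c by (rule someI)
  ultimately have "(SOME c. c \<in> SigP a b, c) \<in> Sig_rel L I a b"
    using c quotient_eq_iff[OF equiv_Sig_rel[OF ab]] by blast
  then show ?thesis
    using perp_Sig_class_eq[OF ab] by (simp add: point_def)
qed

lemma plane_eq:
  assumes ab: "incident_pair L I a b" and c: "c \<in> SigT a b"
  shows "plane a b = perp L I {a, b, c}"
proof -
  have "SigT a b \<in> Sig L I a b // Sig_rel L I a b"
    using label_classes[OF ab] by simp
  moreover have "(SOME c. c \<in> SigT a b) \<in> SigT a b"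
    using c by (rule someI)
  ultimately have "(SOME c. c \<in> SigT a b, c) \<in> Sig_rel L I a b"
    using c quotient_eq_iff[OF equiv_Sig_rel[OF ab]] by blast
  then show ?thesis
    using perp_Sig_class_eq[OF ab] by (simp add: plane_def)
qed

end

locale line_space = labelled_line_space +
  assumes axiom_4:
    "incident_pair L I a b \<Longrightarrow> incident_pair L I p q \<Longrightarrow>
      point a b \<inter> point p q \<noteq> {} \<and> plane a b \<inter> plane p q \<noteq> {}"

text \<open>
  In the projectivity assumption \<open>a, b, c, d\<close> range over all distinct quadruples, so it
  suffices to let \<open>l\<close> meet the first three.
\<close>

locale projective_line_space = line_space +
  assumes projectivity:
    "pairwise_skew L I u v w \<Longrightarrow> {a, b, c, d} \<subseteq> regulus L I u v w \<Longrightarrow> distinct [a, b, c, d] \<Longrightarrow>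
      l \<in> L \<Longrightarrow> I l a \<Longrightarrow> I l b \<Longrightarrow> I l c \<Longrightarrow> I l d"

end

theory Submission
  imports Defs
begin

text \<open>
  Projectivity says that three lines of a regulus already impose on a transversal every incidence
  with the rest of the regulus. So each of \<open>[x\<^sub>1y\<^sub>1z\<^sub>1]\<close> and \<open>[x\<^sub>2y\<^sub>2z\<^sub>2]\<close> equals the set of lines that
  meet the whole of \<open>[uvw]\<close>, a set that does not depend on the chosen triple.
\<close>

context projective_line_space
begin

lemma perp_three_regulus_lines:
  assumes skew: "pairwise_skew L I u v w"
    and sub: "{x, y, z} \<subseteq> regulus L I u v w" and dist: "distinct [x, y, z]"
  shows "perp L I {x, y, z} = perp L I (regulus L I u v w)"
proof
  show "perp L I (regulus L I u v w) \<subseteq> perp L I {x, y, z}"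
    using sub by (auto simp: perp_def)
  show "perp L I {x, y, z} \<subseteq> perp L I (regulus L I u v w)"
  proof
    fix l assume "l \<in> perp L I {x, y, z}"
    then have l: "l \<in> L" "I l x" "I l y" "I l z"
      by (auto simp: perp_def)
    have "I l d" if d: "d \<in> regulus L I u v w" for d
    proof (cases "d \<in> {x, y, z}")
      case True
      then show ?thesis using l by auto
    next
      case False
      then have "{x, y, z, d} \<subseteq> regulus L I u v w" "distinct [x, y, z, d]"
        using sub dist d by auto
      then show ?thesis using projectivity[OF skew] l by blast
    qed
    then show "l \<in> perp L I (regulus L I u v w)"
      using l(1) by (simp add: perp_def)
  qed
qed

end

theorem theorem7:
  fixes L :: "'a set" and I :: "'a \<Rightarrow> 'a \<Rightarrow> bool"
    and SigP SigT :: "'a \<Rightarrow> 'a \<Rightarrow> 'a set"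
    and u v w x1 y1 z1 x2 y2 z2 :: 'a
  assumes "projective_line_space L I SigP SigT"
    and "pairwise_skew L I u v w"
    and "{x1, y1, z1} \<subseteq> regulus L I u v w" and "distinct [x1, y1, z1]"
    and "{x2, y2, z2} \<subseteq> regulus L I u v w" and "distinct [x2, y2, z2]"
  shows "perp L I {x1, y1, z1} = perp L I {x2, y2, z2}"
proof -
  interpret projective_line_space L I SigP SigT by fact
  show ?thesis
    using perp_three_regulus_lines assms(2-6) by simp
qed

end
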